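(* Let $K$ be a compact Hausdorff space. The following are equivalent: (i) $|K|\ge\omega_1$; (ii) $C(K)$ has the SD2P$_\omega$; (iii) $C(K)$ has the 1-ASD2P$_\omega$; (iv) $C(K)^*$ is non-separable; (v) $C(K)^*$ is $\omega$-octahedral; (vi) $C(K)^*$ fails the $(-1)$-BCP$_\omega$.
   Context: $C(K)$ is the real Banach space of continuous real functions on $K$ with the supremum norm; Banach spaces considered are real and infinite-dimensional. $S_X$ is the unit sphere of $X$. For $B\subset X$, $A\subset X^*$ and $\lambda\in(0,1)$, $B$ $\lambda$-norms $A$ if for every $x^*\in A$ there is $x\in B\setminus\{0\}$ with $x^*(x)\ge\lambda\|x^*\|\|x\|$; $B$ norms $A$ if this holds for every $\lambda\in(0,1)$. A normed space $X$ has the SD2P$_\omega$ if for every countable set $A\subset S_{X^*}$ and every $\lambda\in(0,1)$ there are $B\subset S_X$ and $x^*\in S_{X^*}$ such that $B$ $\lambda$-norms $A$ and $x^*(x)\ge\lambda$ for every $x\in B$. $X$ has the 1-ASD2P$_\omega$ if for every countable set $A\subset S_{X^*}$ there are $B\subset S_X$ and $x^*\in S_{X^*}$ such that $B$ norms $A$ and $x^*(x)=1$ for every $x\in B$. (Equivalently, every convex series of slices of the unit ball of $X$ intersects $S_X$.) A normed space $Z$ is $\omega$-octahedral if for every separable subspace $Y\subset Z$ and every $\varepsilon>0$ there is $z\in S_Z$ such that $\|y+\lambda z\|\ge(1-\varepsilon)(\|y\|+|\lambda|)$ for every $y\in Y$ and $\lambda\in\mathbb R$. $Z$ fails the $(-1)$-BCP$_\omega$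 if for every separable subspace $Y\subset Z$ there is $z\in S_Z$ such that $\|y+\lambda z\|\ge\|y\|+|\lambda|$ for every $y\in Y$ and $\lambda\in\mathbb R$. *)

theory Defs
  imports "HOL-Analysis.Analysis"
begin

unbundle cardinal_syntax

text \<open>
  A normed space is a type of class real_normed_vector, passed to the predicates below as
  an \<^verbatim>\<open>itself\<close> argument. Its dual is the type of bounded linear maps into
  the reals with the operator norm, and its unit sphere is \<^term>\<open>sphere 0 1\<close>.
\<close>

definition lnorms :: "real \<Rightarrow> 'x::real_normed_vector set \<Rightarrow> ('x \<Rightarrow>\<^sub>L real) set \<Rightarrow> bool"
  where "lnorms l B A \<longleftrightarrow>
    (\<forall>f\<in>A. \<exists>x\<in>B - {0}. blinfun_apply f x \<ge> l * norm f * norm x)"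

definition norms :: "'x::real_normed_vector set \<Rightarrow> ('x \<Rightarrow>\<^sub>L real) set \<Rightarrow> bool"
  where "norms B A \<longleftrightarrow> (\<forall>l\<in>{0<..<1}. lnorms l B A)"

definition SD2P_omega :: "'x::real_normed_vector itself \<Rightarrow> bool"
  where "SD2P_omega (_ :: 'x itself) \<longleftrightarrow>
    (\<forall>A \<subseteq> sphere (0 :: 'x \<Rightarrow>\<^sub>L real) 1. countable A \<longrightarrow>
      (\<forall>l\<in>{0<..<1}. \<exists>B \<subseteq> sphere (0 :: 'x) 1. \<exists>f \<in> sphere (0 :: 'x \<Rightarrow>\<^sub>L real) 1.
        lnorms l B A \<and> (\<forall>x\<in>B. blinfun_apply f x \<ge> l)))"

definition ASD2P1_omega :: "'x::real_normed_vector itself \<Rightarrow> bool"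
  where "ASD2P1_omega (_ :: 'x itself) \<longleftrightarrow>
    (\<forall>A \<subseteq> sphere (0 :: 'x \<Rightarrow>\<^sub>L real) 1. countable A \<longrightarrow>
      (\<exists>B \<subseteq> sphere (0 :: 'x) 1. \<exists>f \<in> sphere (0 :: 'x \<Rightarrow>\<^sub>L real) 1.
        norms B A \<and> (\<forall>x\<in>B. blinfun_apply f x = 1)))"

definition omega_octahedral :: "'z::real_normed_vector itself \<Rightarrow> bool"
  where "omega_octahedral (_ :: 'z itself) \<longleftrightarrow>
    (\<forall>Y :: 'z set. subspace Y \<and> separable_space (top_of_set Y) \<longrightarrow>
      (\<forall>e>0. \<exists>z \<in> sphere (0 :: 'z) 1. \<forall>y\<in>Y. \<forall>t :: real.
        norm (y + t *\<^sub>R z) \<ge> (1 - e) * (norm y + \<bar>t\<bar>)))"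

definition fails_minus1_BCP_omega :: "'z::real_normed_vector itself \<Rightarrow> bool"
  where "fails_minus1_BCP_omega (_ :: 'z itself) \<longleftrightarrow>
    (\<forall>Y :: 'z set. subspace Y \<and> separable_space (top_of_set Y) \<longrightarrow>
      (\<exists>z \<in> sphere (0 :: 'z) 1. \<forall>y\<in>Y. \<forall>t :: real.
        norm (y + t *\<^sub>R z) \<ge> norm y + \<bar>t\<bar>))"

end

theory Submission
  imports Defs "HOL-Library.Countable_Set_Type"
begin

text \<open>
  A functional \<open>f\<close> on \<open>C(K)\<close> is a signed measure \<open>\<mu>\<close>, and everything turns on its atoms. These
  are read off from \<open>f\<close> itself: the total variation of \<open>\<mu>\<close> on an open set \<open>U\<close> is the supremum of
  \<open>f\<close> over the unit-ball functions that vanish off \<open>U\<close>.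

  Suppose that \<open>K\<close> is uncountable. A functional has only countably many atoms, since functions with
  disjoint supports add up inside the unit ball (\<open>countable_not_negligible\<close>). So countably many
  functionals have a common point \<open>t\<close> at which none of them has mass. An almost norming function
  of such a functional can be altered near \<open>t\<close> to take any prescribed value of
  \<open>[-1, 1]\<close> at \<open>t\<close>, with almost no effect on the functional
  (\<open>almost_norming_with_prescribed_value\<close>). With the value \<open>1\<close>, the evaluation at \<open>t\<close>
  attains its norm at all the functions found, which is the 1-ASD2P\<open>\<^sub>\<omega>\<close>. With the value
  \<open>sgn a\<close>, they show \<open>\<parallel>f + a \<delta>\<^sub>t\<parallel> = \<parallel>f\<parallel> + |a|\<close>, and continuity extends this
  from a countable dense set to a separable subspace, so the dual fails the \<open>(-1)\<close>-BCP\<open>\<^sub>\<omega>\<close>.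

  Suppose that \<open>K\<close> is countable. Near any point \<open>t\<close> a functional is, up to a small error, a multiple
  of the evaluation at \<open>t\<close> (\<open>locally_near_point_eval\<close>). Choosing summable errors over the
  points of \<open>K\<close> and gluing with a finite partition of unity shows that finite combinations of point
  evaluations are dense in the dual (\<open>countable_imp_near_atomic\<close>), which is
  therefore separable. A separable dual is not octahedral, as it contains \<open>- z\<close> for every
  candidate \<open>z\<close>; nor does the space have the SD2P\<open>\<^sub>\<omega>\<close>, as a countable dense set of functionals
  comes arbitrarily close to \<open>- f\<close> for every candidate \<open>f\<close>.

  The remaining implications, 1-ASD2P\<open>\<^sub>\<omega>\<close> to SD2P\<open>\<^sub>\<omega>\<close> and failure of the \<open>(-1)\<close>-BCP\<open>\<^sub>\<omega>\<close>
  to \<open>\<omega>\<close>-octahedrality, hold in every normed space.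
\<close>

section \<open>Continuous functions on a compact Hausdorff space\<close>

lemma bcontfun_of_continuous:
  fixes c :: "'k::topological_space \<Rightarrow> real"
  assumes "compact (UNIV :: 'k set)" "continuous_on UNIV c"
  obtains g :: "'k \<Rightarrow>\<^sub>C real" where "apply_bcontfun g = c"
proof -
  have "c \<in> bcontfun"
    using assms by (auto simp: bcontfun_def intro: compact_imp_bounded compact_continuous_image)
  then show ?thesis
    using that[of "Bcontfun c"] Bcontfun_inverse[of c] by simp
qed

lemma norm_le_1_bcontfun_iff:
  fixes g :: "'k::topological_space \<Rightarrow>\<^sub>C real"
  shows "norm g \<le> 1 \<longleftrightarrow> (\<forall>x. \<bar>g x\<bar> \<le> 1)"
  using norm_bounded[of g] norm_bound[of g 1] by (auto intro: order_trans)

lemma Hausdorff_space_euclidean_t2: "Hausdorff_space (euclidean :: 'k::t2_space topology)"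
  unfolding Hausdorff_space_def disjnt_def by (simp add: hausdorff flip: ex_simps)

lemma urysohn_bump:
  fixes t :: "'k::t2_space"
  assumes K: "compact (UNIV :: 'k set)" and U: "open U" "t \<in> U"
  obtains p :: "'k \<Rightarrow>\<^sub>C real"
  where "p t = 1" "\<And>x. 0 \<le> p x" "\<And>x. p x \<le> 1" "\<And>x. x \<notin> U \<Longrightarrow> p x = 0"
proof -
  have "compact_space (euclidean :: 'k topology)"
    using K by (simp add: compact_space_def)
  then have "normal_space (euclidean :: 'k topology)"
    by (simp add: compact_Hausdorff_or_regular_imp_normal_space Hausdorff_space_euclidean_t2)
  moreover have "closedin euclidean (- U)" "closedin euclidean {t}" "disjnt (- U) {t}"
    using U by (auto simp: disjnt_def)
  ultimately obtain c where c: "continuous_map euclidean (top_of_set {0..1::real}) c"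
    "c ` (- U) \<subseteq> {0}" "c ` {t} \<subseteq> {1}"
    using Urysohn_lemma[of euclidean "- U" "{t}" "0::real" 1] by auto
  from c(1) have "continuous_on UNIV c" and c01: "\<And>x. c x \<in> {0..1}"
    by (auto simp: continuous_map_in_subtopology)
  then obtain p :: "'k \<Rightarrow>\<^sub>C real" where "apply_bcontfun p = c"
    using bcontfun_of_continuous[OF K] by blast
  with c c01 show ?thesis
    by (intro that[of p]) (auto simp: image_subset_iff)
qed

text \<open>
  The unit-ball functions that vanish off \<open>U\<close>: the supremum of \<open>f\<close> over this set is
  \<open>|\<mu>|(U)\<close> for open \<open>U\<close> and the measure \<open>\<mu>\<close> that represents \<open>f\<close>.
\<close>

definition ball_on :: "'k::topological_space set \<Rightarrow> ('k \<Rightarrow>\<^sub>C real) set"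
  where "ball_on U = {g. norm g \<le> 1 \<and> (\<forall>x. x \<notin> U \<longrightarrow> apply_bcontfun g x = 0)}"

lemma ball_on_iff:
  "g \<in> ball_on U \<longleftrightarrow>
    (\<forall>x. \<bar>apply_bcontfun g x\<bar> \<le> 1) \<and> (\<forall>x. x \<notin> U \<longrightarrow> apply_bcontfun g x = 0)"
  by (simp add: ball_on_def norm_le_1_bcontfun_iff)

lemma ball_on_mono: "U \<subseteq> V \<Longrightarrow> ball_on U \<subseteq> ball_on V"
  by (auto simp: ball_on_def)

lemma uminus_ball_on: "g \<in> ball_on U \<Longrightarrow> - g \<in> ball_on U"
  by (simp add: ball_on_iff)

lemma ball_on_add_disjoint:
  assumes "g \<in> ball_on U" "h \<in> ball_on V" "U \<inter> V = {}"
  shows "g + h \<in> ball_on (U \<union> V)"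
proof -
  have "\<bar>g x + h x\<bar> \<le> 1" for x
  proof -
    have "g x = 0 \<or> h x = 0"
      using assms unfolding ball_on_iff by blast
    moreover have "\<bar>g x\<bar> \<le> 1" "\<bar>h x\<bar> \<le> 1"
      using assms unfolding ball_on_iff by blast+
    ultimately show ?thesis by auto
  qed
  then show ?thesis
    using assms by (simp add: ball_on_iff)
qed

lemma functional_le_norm:
  fixes f :: "('k::topological_space \<Rightarrow>\<^sub>C real) \<Rightarrow>\<^sub>L real"
  assumes "g \<in> ball_on U"
  shows "blinfun_apply f g \<le> norm f"
proof -
  have "blinfun_apply f g \<le> norm f * norm g"
    using norm_blinfun[of f g] by simp
  also have "\<dots> \<le> norm f"
    using assms by (simp add: ball_on_def mult_left_le)
  finally show ?thesis .
qed

lemma functional_almost_attains_norm: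
  fixes f :: "'x::real_normed_vector \<Rightarrow>\<^sub>L real"
  assumes "e > 0"
  obtains h where "norm h \<le> 1" "blinfun_apply f h > norm f - e"
proof (cases "norm f < e")
  case True
  then show ?thesis
    using that[of 0] by simp
next
  case False
  then have "\<exists>x. \<not> \<bar>blinfun_apply f x\<bar> \<le> (norm f - e) * norm x"
    using norm_blinfun_bound[of "norm f - e" f] assms by fastforce
  then obtain x where x: "\<bar>blinfun_apply f x\<bar> > (norm f - e) * norm x"
    by (auto simp: not_le)
  then have "x \<noteq> 0"
    by auto
  \<comment> \<open>The unit vector \<open>\<plusminus> x / \<parallel>x\<parallel>\<close>, with the sign that makes \<open>f\<close> positive.\<close>
  define h where "h = (sgn (blinfun_apply f x) / norm x) *\<^sub>R x"
  have "norm h \<le> 1"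
    using \<open>x \<noteq> 0\<close> by (simp add: h_def abs_sgn_eq)
  moreover have "blinfun_apply f h = \<bar>blinfun_apply f x\<bar> / norm x"
    by (simp add: h_def blinfun.scaleR_right abs_sgn mult.commute)
  then have "blinfun_apply f h > norm f - e"
    using x \<open>x \<noteq> 0\<close> by (simp add: pos_less_divide_eq)
  ultimately show ?thesis
    by (rule that)
qed

section \<open>Point evaluations\<close>

definition point_eval :: "'k::topological_space \<Rightarrow> ('k \<Rightarrow>\<^sub>C real) \<Rightarrow>\<^sub>L real"
  where "point_eval t = Blinfun (\<lambda>g. apply_bcontfun g t)"

lemma point_eval_apply [simp]: "blinfun_apply (point_eval t) g = apply_bcontfun g t"
proof -
  have "bounded_linear (\<lambda>g :: 'a \<Rightarrow>\<^sub>C real. apply_bcontfun g t)"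
    by (rule bounded_linear_intro[where K = 1])
       (auto simp: norm_bounded simp flip: real_norm_def)
  then show ?thesis
    by (simp add: point_eval_def bounded_linear_Blinfun_apply)
qed

lemma norm_point_eval: "norm (point_eval t) = 1"
proof (rule antisym)
  show "norm (point_eval t) \<le> 1"
    by (rule norm_blinfun_bound) (auto simp: norm_bounded simp flip: real_norm_def)
  have "const_bcontfun 1 \<in> ball_on (UNIV :: 'a set)"
    by (simp add: ball_on_iff const_bcontfun.rep_eq)
  then have "blinfun_apply (point_eval t) (const_bcontfun 1) \<le> norm (point_eval t)"
    by (rule functional_le_norm)
  then show "1 \<le> norm (point_eval t)"
    by (simp add: const_bcontfun.rep_eq)
qed

section \<open>Points without mass\<close>

text \<open>This says that \<open>|\<mu>|({t}) = 0\<close> for the measure \<open>\<mu>\<close> that represents \<open>f\<close>.\<close>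

definition negligible_at :: "(('k::topological_space \<Rightarrow>\<^sub>C real) \<Rightarrow>\<^sub>L real) \<Rightarrow> 'k \<Rightarrow> bool"
  where "negligible_at f t \<longleftrightarrow>
    (\<forall>e>0. \<exists>U. open U \<and> t \<in> U \<and> (\<forall>g\<in>ball_on U. \<bar>blinfun_apply f g\<bar> \<le> e))"

text \<open>
  Distinct points have disjoint neighbourhoods, and unit-ball functions supported in these can be
  added up without leaving the unit ball. Confining the supports to an arbitrary open \<open>V\<close> makes the
  induction work: it leaves room for the next point.
\<close>

lemma heavy_points_add_up:
  fixes f :: "('k::t2_space \<Rightarrow>\<^sub>C real) \<Rightarrow>\<^sub>L real"
  assumes "finite F"
    and "\<And>t U. t \<in> F \<Longrightarrow> open U \<Longrightarrow> t \<in> U \<Longrightarrow> \<exists>g\<in>ball_on U. blinfun_apply f g > d"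
    and "open V" "F \<subseteq> V"
  shows "\<exists>h\<in>ball_on V. blinfun_apply f h \<ge> d * card F"
  using assms
proof (induction F arbitrary: V rule: finite_induct)
  case empty
  then show ?case
    by (intro bexI[of _ 0]) (auto simp: ball_on_iff)
next
  case (insert t F)
  have "t \<notin> F" "compact F"
    using insert.hyps by (auto intro: finite_imp_compact)
  have "\<exists>A B. open A \<and> open B \<and> t \<in> A \<and> F \<subseteq> B \<and> A \<inter> B = {}"
    using Hausdorff_space_euclidean_t2[where 'k = 'k, unfolded Hausdorff_space_compact_sets,
      rule_format, of "{t}" F] \<open>t \<notin> F\<close> \<open>compact F\<close> by (auto simp: disjnt_def)
  then obtain A B where AB: "open A" "open B" "t \<in> A" "F \<subseteq> B" "A \<inter> B = {}"
    by blast
  obtain h where h: "h \<in> ball_on (V \<inter> B)" "blinfun_apply f h \<ge> d * card F"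
    using insert.IH[of "V \<inter> B"] insert.prems AB by (auto intro: open_Int)
  obtain g where g: "g \<in> ball_on (V \<inter> A)" "blinfun_apply f g > d"
    using insert.prems(1)[of t "V \<inter> A"] insert.prems AB by (auto intro: open_Int)
  have "g + h \<in> ball_on (V \<inter> A \<union> V \<inter> B)"
    using g h AB by (intro ball_on_add_disjoint) auto
  then have "g + h \<in> ball_on V"
    using ball_on_mono[of "V \<inter> A \<union> V \<inter> B" V] by blast
  moreover have "blinfun_apply f (g + h) \<ge> d * card (insert t F)"
    using g h insert.hyps by (simp add: blinfun.add_right algebra_simps)
  ultimately show ?case
    by blast
qed

lemma countable_not_negligible:
  fixes f :: "('k::t2_space \<Rightarrow>\<^sub>C real) \<Rightarrow>\<^sub>L real"
  shows "countable {t. \<not> negligible_at f t}"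
proof -
  define H where "H n = {t. \<forall>U. open U \<longrightarrow> t \<in> U \<longrightarrow>
    (\<exists>g\<in>ball_on U. blinfun_apply f g > inverse (real (Suc n)))}" for n
  have "finite (H n)" for n
  proof -
    have "card F \<le> nat \<lceil>norm f * real (Suc n)\<rceil>" if F: "F \<subseteq> H n" "finite F" for F
    proof -
      obtain h where "h \<in> ball_on UNIV" "blinfun_apply f h \<ge> inverse (real (Suc n)) * card F"
        using heavy_points_add_up[of F "inverse (real (Suc n))" f UNIV] F by (auto simp: H_def)
      then have "inverse (real (Suc n)) * card F \<le> norm f"
        using functional_le_norm[of h UNIV f] by simp
      then have "card F \<le> norm f * real (Suc n)"
        by (simp add: field_simps)
      then show ?thesis
        by linarith
    qed
    then show ?thesis
      using finite_if_finite_subsets_card_bdd by metis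
  qed
  moreover have "{t. \<not> negligible_at f t} \<subseteq> (\<Union>n. H n)"
  proof
    fix t assume "t \<in> {t. \<not> negligible_at f t}"
    then obtain e where e: "e > 0"
      and *: "\<And>U. open U \<Longrightarrow> t \<in> U \<Longrightarrow> \<exists>g\<in>ball_on U. \<bar>blinfun_apply f g\<bar> > e"
      by (auto simp: negligible_at_def not_le)
    obtain n where n: "inverse (real (Suc n)) < e"
      using reals_Archimedean[OF e] by blast
    have "\<exists>g\<in>ball_on U. blinfun_apply f g > inverse (real (Suc n))"
      if U: "open U" "t \<in> U" for U
    proof -
      obtain g where g: "g \<in> ball_on U" "\<bar>blinfun_apply f g\<bar> > e"
        using *[OF U] by blast
      then have "blinfun_apply f g > e \<or> blinfun_apply f (- g) > e"
        by (auto simp: blinfun.minus_right)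
      then show ?thesis
        using g(1) uminus_ball_on[OF g(1)] n by (auto intro: less_trans)
    qed
    then show "t \<in> (\<Union>n. H n)"
      unfolding H_def by blast
  qed
  ultimately show ?thesis
    by (meson countable_UN countable_finite countable_subset countableI_type)
qed

text \<open>
  Near a point without mass an almost norming function can be deformed to take any value in
  \<open>[-1, 1]\<close> at that point, at almost no cost for the functional.
\<close>

lemma almost_norming_with_prescribed_value:
  fixes f :: "('k::t2_space \<Rightarrow>\<^sub>C real) \<Rightarrow>\<^sub>L real"
  assumes K: "compact (UNIV :: 'k set)" and f: "negligible_at f t"
    and s: "\<bar>s\<bar> \<le> 1" and e: "e > 0"
  obtains x :: "'k \<Rightarrow>\<^sub>C real"
  where "norm x \<le> 1" "x t = s" "blinfun_apply f x \<ge> norm f - e"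
proof -
  obtain h :: "'k \<Rightarrow>\<^sub>C real"
    where h: "norm h \<le> 1" "blinfun_apply f h > norm f - e / 2"
    using functional_almost_attains_norm[of "e / 2" f] e by auto
  obtain U where U: "open U" "t \<in> U" "\<And>g. g \<in> ball_on U \<Longrightarrow> \<bar>blinfun_apply f g\<bar> \<le> e / 4"
    using f e unfolding negligible_at_def by (metis zero_less_divide_iff zero_less_numeral)
  obtain p :: "'k \<Rightarrow>\<^sub>C real" where p: "p t = 1" "\<And>y. 0 \<le> p y" "\<And>y. p y \<le> 1"
    "\<And>y. y \<notin> U \<Longrightarrow> p y = 0"
    using urysohn_bump[OF K U(1,2)] by blast
  have "continuous_on UNIV (\<lambda>y. p y * (s - h y) / 2)"
    by (intro continuous_intros) auto
  then obtain g :: "'k \<Rightarrow>\<^sub>C real" where g: "apply_bcontfun g = (\<lambda>y. p y * (s - h y) / 2)"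
    using bcontfun_of_continuous[OF K] by blast
  have h1: "\<bar>h y\<bar> \<le> 1" for y
    using h(1) by (simp add: norm_le_1_bcontfun_iff)
  have "\<bar>p y * (s - h y) / 2\<bar> \<le> 1" for y
  proof -
    have "\<bar>p y * (s - h y)\<bar> \<le> 1 * 2"
      unfolding abs_mult using p(2,3)[of y] h1[of y] s by (intro mult_mono) auto
    then show ?thesis by simp
  qed
  then have "g \<in> ball_on U"
    using p(4) by (simp add: ball_on_iff g)
  then have fg: "\<bar>blinfun_apply f g\<bar> \<le> e / 4"
    by (rule U)
  define x where "x = h + 2 *\<^sub>R g"
  have x: "x y = (1 - p y) * h y + p y * s" for y
    by (simp add: x_def g field_simps)
  have "\<bar>x y\<bar> \<le> 1" for y
  proof -
    have "\<bar>x y\<bar> \<le> \<bar>(1 - p y) * h y\<bar> + \<bar>p y * s\<bar>"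
      unfolding x by (rule abs_triangle_ineq)
    also have "\<dots> \<le> (1 - p y) * 1 + p y * 1"
      unfolding abs_mult using p(2,3)[of y] h1[of y] s by (intro add_mono mult_mono) auto
    finally show ?thesis by simp
  qed
  then have "norm x \<le> 1"
    by (simp add: norm_le_1_bcontfun_iff)
  moreover have "x t = s"
    by (simp add: x p(1))
  moreover have "blinfun_apply f x \<ge> norm f - e"
    using h(2) fg by (simp add: x_def blinfun.add_right blinfun.scaleR_right)
  ultimately show ?thesis
    by (rule that)
qed

section \<open>Uncountable spaces\<close>

lemma common_negligible_point:
  fixes A :: "(('k::t2_space \<Rightarrow>\<^sub>C real) \<Rightarrow>\<^sub>L real) set"
  assumes "uncountable (UNIV :: 'k set)" "countable A"
  obtains t where "\<And>f. f \<in> A \<Longrightarrow> negligible_at f t"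
proof -
  have "countable (\<Union>f\<in>A. {t. \<not> negligible_at f t})"
    using assms(2) countable_not_negligible by blast
  then have "(\<Union>f\<in>A. {t. \<not> negligible_at f t}) \<noteq> UNIV"
    using assms(1) by metis
  then show ?thesis
    using that by blast
qed

lemma uncountable_imp_ASD2P1_omega:
  assumes K: "compact (UNIV :: 'k::t2_space set)" and unc: "uncountable (UNIV :: 'k set)"
  shows "ASD2P1_omega TYPE('k \<Rightarrow>\<^sub>C real)"
  unfolding ASD2P1_omega_def
proof (intro allI impI)
  fix A :: "(('k \<Rightarrow>\<^sub>C real) \<Rightarrow>\<^sub>L real) set"
  assume A: "A \<subseteq> sphere 0 1" "countable A"
  obtain t where t: "\<And>f. f \<in> A \<Longrightarrow> negligible_at f t"
    using common_negligible_point[OF unc A(2)] by blast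
  define B where "B = {x \<in> sphere (0 :: 'k \<Rightarrow>\<^sub>C real) 1. x t = 1}"
  have "\<exists>x\<in>B - {0}. blinfun_apply f x \<ge> l * norm f * norm x"
    if l: "l \<in> {0<..<1}" and f: "f \<in> A" for l f
  proof -
    obtain x :: "'k \<Rightarrow>\<^sub>C real" where x: "norm x \<le> 1" "x t = 1" "blinfun_apply f x \<ge> norm f - (1 - l)"
      using almost_norming_with_prescribed_value[OF K t[OF f], of 1 "1 - l"] l by auto
    have "norm x \<ge> 1"
      using norm_bounded[of x t] x(2) by simp
    with x have "norm x = 1" by simp
    moreover have "norm f = 1"
      using A f by auto
    ultimately show ?thesis
      using x by (intro bexI[of _ x]) (auto simp: B_def)
  qed
  then have "norms B A"
    by (auto simp: norms_def lnorms_def)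
  moreover have "B \<subseteq> sphere 0 1" "\<forall>x\<in>B. blinfun_apply (point_eval t) x = 1"
    "point_eval t \<in> sphere 0 1"
    by (auto simp: B_def norm_point_eval)
  ultimately show "\<exists>B\<subseteq>sphere 0 1. \<exists>f\<in>sphere 0 1.
      norms B A \<and> (\<forall>x\<in>B. blinfun_apply f x = (1::real))"
    by blast
qed

text \<open>
  A function that almost norms \<open>f\<close> and takes the value \<open>sgn a\<close> at \<open>t\<close> almost norms both summands.
\<close>

lemma norm_add_point_eval_negligible:
  fixes f :: "('k::t2_space \<Rightarrow>\<^sub>C real) \<Rightarrow>\<^sub>L real"
  assumes K: "compact (UNIV :: 'k set)" and f: "negligible_at f t"
  shows "norm (f + a *\<^sub>R point_eval t) \<ge> norm f + \<bar>a\<bar>"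
proof (rule field_le_epsilon)
  fix e :: real assume "e > 0"
  then obtain x :: "'k \<Rightarrow>\<^sub>C real" where x: "norm x \<le> 1" "x t = sgn a" "blinfun_apply f x \<ge> norm f - e"
    using almost_norming_with_prescribed_value[OF K f, of "sgn a" e] by (auto simp: abs_sgn_eq)
  have "norm f + \<bar>a\<bar> - e \<le> blinfun_apply (f + a *\<^sub>R point_eval t) x"
    using x(2,3) by (simp add: plus_blinfun.rep_eq scaleR_blinfun.rep_eq abs_sgn)
  also have "\<dots> \<le> norm (f + a *\<^sub>R point_eval t)"
    using x(1) by (intro functional_le_norm[of _ UNIV]) (simp add: ball_on_def)
  finally show "norm f + \<bar>a\<bar> \<le> norm (f + a *\<^sub>R point_eval t) + e"
    by simp
qed

lemma uncountable_imp_fails_minus1_BCP_omega: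
  assumes K: "compact (UNIV :: 'k::t2_space set)" and unc: "uncountable (UNIV :: 'k set)"
  shows "fails_minus1_BCP_omega TYPE(('k \<Rightarrow>\<^sub>C real) \<Rightarrow>\<^sub>L real)"
  unfolding fails_minus1_BCP_omega_def
proof (intro allI impI)
  fix Y :: "(('k \<Rightarrow>\<^sub>C real) \<Rightarrow>\<^sub>L real) set"
  assume "subspace Y \<and> separable_space (top_of_set Y)"
  then obtain D where D: "countable D" "D \<subseteq> Y" "top_of_set Y closure_of D = Y"
    by (auto simp: separable_space_def)
  then have "Y \<subseteq> closure D"
    by (auto simp: closure_of_subtopology Int_absorb1)
  obtain t where t: "\<And>f. f \<in> D \<Longrightarrow> negligible_at f t"
    using common_negligible_point[OF unc D(1)] by blast
  have "norm (y + a *\<^sub>R point_eval t) \<ge> norm y + \<bar>a\<bar>" if y: "y \<in> Y" for y a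
  proof -
    obtain X where X: "\<And>n. X n \<in> D" "X \<longlonglongrightarrow> y"
      using \<open>Y \<subseteq> closure D\<close> y closure_sequential[of y D] by blast
    have "(\<lambda>n. norm (X n + a *\<^sub>R point_eval t)) \<longlonglongrightarrow> norm (y + a *\<^sub>R point_eval t)"
      "(\<lambda>n. norm (X n) + \<bar>a\<bar>) \<longlonglongrightarrow> norm y + \<bar>a\<bar>"
      using X(2) by (auto intro!: tendsto_intros)
    then show ?thesis
      by (rule tendsto_le[OF sequentially_bot])
         (simp add: norm_add_point_eval_negligible[OF K t] X(1))
  qed
  then show "\<exists>z\<in>sphere 0 1. \<forall>y\<in>Y. \<forall>a. norm y + \<bar>a\<bar> \<le> norm (y + a *\<^sub>R z)"
    by (intro bexI[of _ "point_eval t"]) (auto simp: norm_point_eval)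
qed

section \<open>Countable spaces\<close>

text \<open>
  Mass cannot accumulate at \<open>t\<close> off the point \<open>t\<close> itself. Otherwise any neighbourhood \<open>W\<close> of \<open>t\<close>
  supports a unit-ball function that vanishes at \<open>t\<close> and at which \<open>f\<close> exceeds \<open>e\<close>. Shrinking its
  values towards \<open>0\<close> by a small \<open>\<eta>\<close> makes it vanish near \<open>t\<close> and leaves a value of at least
  \<open>e / 2\<close>. The construction can then be repeated in a smaller neighbourhood, and the disjointly
  supported functions add up to contradict the boundedness of \<open>f\<close>.
\<close>

lemma small_near_point:
  fixes f :: "('k::t2_space \<Rightarrow>\<^sub>C real) \<Rightarrow>\<^sub>L real"
  assumes K: "compact (UNIV :: 'k set)" and e: "e > 0"
  shows "\<exists>U. open U \<and> t \<in> U \<and>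
    (\<forall>g\<in>ball_on U. apply_bcontfun g t = 0 \<longrightarrow> \<bar>blinfun_apply f g\<bar> \<le> e)"
proof (rule ccontr)
  assume no: "\<not> ?thesis"
  have neg: "\<exists>g\<in>ball_on U. apply_bcontfun g t = 0 \<and> \<bar>blinfun_apply f g\<bar> > e" if "open U" "t \<in> U" for U
    using no that by (auto simp: not_le)
  define \<eta> where "\<eta> = e / (2 * (norm f + 1))"
  have \<eta>: "\<eta> > 0"
    using e by (simp add: \<eta>_def add_nonneg_pos)
  have f\<eta>: "norm f * \<eta> \<le> e / 2"
  proof -
    have "norm f * \<eta> \<le> (norm f + 1) * \<eta>"
      using \<eta> by (simp add: mult_right_mono)
    also have "\<dots> = e / 2"
      using norm_ge_zero[of f] by (simp add: \<eta>_def field_simps add_nonneg_eq_0_iff)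
    finally show ?thesis .
  qed
  have step: "\<exists>h W'. h \<in> ball_on (W - W') \<and> open W' \<and> t \<in> W' \<and> W' \<subseteq> W \<and>
    blinfun_apply f h \<ge> e / 2" if W: "open W" "t \<in> W" for W
  proof -
    obtain g0 where g0: "g0 \<in> ball_on W" "g0 t = 0" "\<bar>blinfun_apply f g0\<bar> > e"
      using neg[OF W] by blast
    obtain g where g: "g \<in> ball_on W" "g t = 0" "blinfun_apply f g > e"
    proof (cases "blinfun_apply f g0 > e")
      case True
      then show ?thesis using g0 that by blast
    next
      case False
      then show ?thesis
        using g0 uminus_ball_on[OF g0(1)] by (intro that[of "- g0"]) (auto simp: blinfun.minus_right)
    qed
    \<comment> \<open>Subtracting the truncation \<open>r\<close> of \<open>g\<close> to \<open>[-\<eta>, \<eta>]\<close> shrinks \<open>g\<close> towards \<open>0\<close> by \<open>\<eta>\<close>.\<close>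
    have "continuous_on UNIV (\<lambda>x. max (- \<eta>) (min \<eta> (g x)))"
      by (intro continuous_intros) auto
    then obtain r :: "'k \<Rightarrow>\<^sub>C real" where r: "apply_bcontfun r = (\<lambda>x. max (- \<eta>) (min \<eta> (g x)))"
      using bcontfun_of_continuous[OF K] by blast
    define W' where "W' = W \<inter> {x. \<bar>g x\<bar> < \<eta>}"
    have "open {x. \<bar>g x\<bar> < \<eta>}"
      by (intro open_Collect_less continuous_intros) auto
    then have "open W'"
      using W by (auto simp: W'_def)
    moreover have "t \<in> W'"
      using W g \<eta> by (simp add: W'_def)
    moreover have "W' \<subseteq> W"
      by (simp add: W'_def)
    moreover have "g - r \<in> ball_on (W - W')"
      unfolding ball_on_iff
    proof (intro conjI allI impI)
      fix x
      have "\<bar>g x\<bar> \<le> 1"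
        using g by (simp add: ball_on_iff)
      then show "\<bar>(g - r) x\<bar> \<le> 1"
        using \<eta> by (auto simp: r max_def min_def)
      assume "x \<notin> W - W'"
      then have "g x = 0 \<or> \<bar>g x\<bar> < \<eta>"
        using g by (auto simp: W'_def ball_on_iff)
      then show "(g - r) x = 0"
        using \<eta> by (auto simp: r max_def min_def)
    qed
    moreover have "norm r \<le> \<eta>"
      using \<eta> by (intro norm_bound) (auto simp: r max_def min_def)
    then have "norm f * norm r \<le> norm f * \<eta>"
      by (simp add: mult_left_mono)
    then have "\<bar>blinfun_apply f r\<bar> \<le> norm f * \<eta>"
      using norm_blinfun[of f r] by simp
    then have "blinfun_apply f (g - r) \<ge> e / 2"
      using f\<eta> g(3) by (simp add: blinfun.diff_right)
    ultimately show ?thesis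
      by blast
  qed
  have "\<exists>h W. open W \<and> t \<in> W \<and> h \<in> ball_on (- W) \<and> blinfun_apply f h \<ge> n * (e / 2)" for n :: nat
  proof (induction n)
    case 0
    show ?case
      by (intro exI[of _ 0] exI[of _ UNIV]) (auto simp: ball_on_iff)
  next
    case (Suc n)
    then obtain h W where h: "open W" "t \<in> W" "h \<in> ball_on (- W)" "blinfun_apply f h \<ge> n * (e / 2)"
      by blast
    obtain h' W' where h': "h' \<in> ball_on (W - W')" "open W'" "t \<in> W'" "W' \<subseteq> W"
      "blinfun_apply f h' \<ge> e / 2"
      using step[OF h(1,2)] by blast
    have "h + h' \<in> ball_on (- W \<union> (W - W'))"
      using h h' by (intro ball_on_add_disjoint) auto
    also have "- W \<union> (W - W') = - W'"
      using h' by auto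
    finally show ?case
      using h h' by (intro exI[of _ "h + h'"] exI[of _ W'])
        (simp add: blinfun.add_right algebra_simps add_divide_distrib)
  qed
  then have "n * (e / 2) \<le> norm f" for n :: nat
    using functional_le_norm order_trans by metis
  moreover obtain n :: nat where "norm f < n * (e / 2)"
    using e reals_Archimedean3[of "e / 2"] by auto
  ultimately show False
    by (meson not_le)
qed

text \<open>
  Subtracting \<open>g(t) p\<close> from \<open>g\<close>, for a bump \<open>p\<close> at \<open>t\<close>, gives a function that vanishes at \<open>t\<close>; so the
  coefficient \<open>a = f(p)\<close> serves.
\<close>

lemma locally_near_point_eval:
  fixes f :: "('k::t2_space \<Rightarrow>\<^sub>C real) \<Rightarrow>\<^sub>L real"
  assumes K: "compact (UNIV :: 'k set)" and e: "e > 0"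
  obtains U a where "open U" "t \<in> U" "\<And>g. g \<in> ball_on U \<Longrightarrow> \<bar>blinfun_apply f g - a * g t\<bar> \<le> e"
proof -
  obtain U where U: "open U" "t \<in> U"
    "\<And>g. g \<in> ball_on U \<Longrightarrow> apply_bcontfun g t = 0 \<Longrightarrow> \<bar>blinfun_apply f g\<bar> \<le> e / 2"
    using small_near_point[OF K, of "e / 2" t f] e by (metis half_gt_zero)
  obtain p :: "'k \<Rightarrow>\<^sub>C real" where p: "p t = 1" "\<And>y. 0 \<le> p y" "\<And>y. p y \<le> 1"
    "\<And>y. y \<notin> U \<Longrightarrow> p y = 0"
    using urysohn_bump[OF K U(1,2)] by blast
  have "\<bar>blinfun_apply f g - blinfun_apply f p * g t\<bar> \<le> e" if g: "g \<in> ball_on U" for g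
  proof -
    \<comment> \<open>The factor \<open>1/2\<close> brings the difference back into the unit ball.\<close>
    define h where "h = (1/2) *\<^sub>R (g - g t *\<^sub>R p)"
    have "\<bar>h y\<bar> \<le> 1" for y
    proof -
      have "\<bar>g y - g t * p y\<bar> \<le> \<bar>g y\<bar> + \<bar>g t\<bar> * \<bar>p y\<bar>"
        using abs_triangle_ineq4[of "g y" "g t * p y"] by (simp add: abs_mult)
      also have "\<dots> \<le> 1 + 1 * 1"
        using g p(2,3)[of y] by (intro add_mono mult_mono) (auto simp: ball_on_iff)
      finally show ?thesis
        by (simp add: h_def)
    qed
    then have "h \<in> ball_on U" "h t = 0"
      using g p by (auto simp: ball_on_iff h_def)
    from U(3)[OF this] show ?thesis
      by (simp add: h_def blinfun.diff_right blinfun.scaleR_right mult.commute)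
  qed
  then show ?thesis
    using that U by blast
qed

text \<open>
  On a countable space the local approximations at the points \<open>t\<^sub>0, t\<^sub>1, \<dots>\<close> can be chosen with
  errors \<open>e / 2 ^ (n + 1)\<close>. Finitely many of the neighbourhoods cover the space, and a
  partition of unity glues the approximations, at the price of a total error at most \<open>e\<close>.
\<close>

lemma countable_imp_near_atomic:
  fixes f :: "('k::t2_space \<Rightarrow>\<^sub>C real) \<Rightarrow>\<^sub>L real"
  assumes K: "compact (UNIV :: 'k set)" and cnt: "countable (UNIV :: 'k set)" and e: "e > 0"
  obtains F a where "finite F" "norm (f - (\<Sum>t\<in>F. a t *\<^sub>R point_eval t)) \<le> e"
proof -
  define idx where "idx = to_nat_on (UNIV :: 'k set)"
  have inj: "inj idx"
    unfolding idx_def by (rule inj_on_to_nat_on[OF cnt])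
  define d where "d t = e * (1/2) ^ Suc (idx t)" for t
  have "d t > 0" for t
    using e by (simp add: d_def)
  then have "\<exists>U a. open U \<and> t \<in> U \<and> (\<forall>g\<in>ball_on U. \<bar>blinfun_apply f g - a * g t\<bar> \<le> d t)" for t
    using locally_near_point_eval[OF K, of "d t" t f] by metis
  then obtain U a where U: "\<And>t. open (U t)" "\<And>t. t \<in> U t"
    "\<And>t g. g \<in> ball_on (U t) \<Longrightarrow> \<bar>blinfun_apply f g - a t * g t\<bar> \<le> d t"
    by metis
  have "\<exists>p :: 'k \<Rightarrow>\<^sub>C real. p t = 1 \<and> (\<forall>x. 0 \<le> p x) \<and> (\<forall>x. x \<notin> U t \<longrightarrow> p x = 0)" for t
    using urysohn_bump[OF K U(1,2), of t] by metis
  then obtain p :: "'k \<Rightarrow> 'k \<Rightarrow>\<^sub>C real" where p: "\<And>t. p t t = 1" "\<And>t x. 0 \<le> p t x"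
    "\<And>t x. x \<notin> U t \<Longrightarrow> p t x = 0"
    by metis
  have "open {x. 0 < p t x}" for t
    by (intro open_Collect_less continuous_intros) auto
  moreover have "UNIV \<subseteq> (\<Union>t\<in>UNIV. {x. 0 < p t x})"
  proof
    fix x
    show "x \<in> (\<Union>t\<in>UNIV. {x. 0 < p t x})"
      by (rule UN_I[of x]) (simp_all add: p(1))
  qed
  ultimately obtain F where F: "finite F" "UNIV \<subseteq> (\<Union>t\<in>F. {x. 0 < p t x})"
    using compactE_image[OF K, of UNIV "\<lambda>t. {x. 0 < p t x}"] by metis
  define q where "q x = (\<Sum>t\<in>F. p t x)" for x
  have q: "q x > 0" for x
  proof -
    obtain t where "t \<in> F" "0 < p t x"
      using F by blast
    then show ?thesis
      unfolding q_def using F p(2) by (intro sum_pos2[of _ t]) auto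
  qed
  have qc: "continuous_on UNIV q"
    unfolding q_def by (intro continuous_intros) auto
  \<comment> \<open>The glued piece at \<open>t\<close> has weight \<open>p t / q\<close>, whose value at \<open>t\<close> is \<open>1 / q t\<close>.\<close>
  define b where "b t = a t / q t" for t
  have "norm (f - (\<Sum>t\<in>F. b t *\<^sub>R point_eval t)) \<le> e"
  proof (rule field_le_epsilon)
    fix e' :: real assume "e' > 0"
    let ?m = "\<Sum>t\<in>F. b t *\<^sub>R point_eval t"
    obtain h :: "'k \<Rightarrow>\<^sub>C real"
      where h: "norm h \<le> 1" "blinfun_apply (f - ?m) h > norm (f - ?m) - e'"
      using functional_almost_attains_norm[OF \<open>e' > 0\<close>, of "f - ?m"] .
    have h1: "\<bar>h x\<bar> \<le> 1" for x
      using h(1) by (simp add: norm_le_1_bcontfun_iff)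
    have "\<exists>g :: 'k \<Rightarrow>\<^sub>C real. apply_bcontfun g = (\<lambda>x. h x * (p t x / q x))" for t
    proof -
      have "continuous_on UNIV (\<lambda>x. h x * (p t x / q x))"
        using q by (intro continuous_intros qc) (auto simp: less_imp_neq[symmetric])
      then show ?thesis
        using bcontfun_of_continuous[OF K] by metis
    qed
    then obtain g :: "'k \<Rightarrow> 'k \<Rightarrow>\<^sub>C real" where
      g: "\<And>t x. g t x = h x * (p t x / q x)"
      by metis
    have gU: "g t \<in> ball_on (U t)" if "t \<in> F" for t
      unfolding ball_on_iff
    proof (intro conjI allI impI)
      fix x
      have "p t x \<le> q x"
        unfolding q_def using F p(2) that by (intro member_le_sum) auto
      then have "\<bar>p t x / q x\<bar> \<le> 1"
        using q[of x] p(2)[of t x] by simp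
      then have "\<bar>h x\<bar> * \<bar>p t x / q x\<bar> \<le> 1 * 1"
        using h1 by (intro mult_mono) auto
      then show "\<bar>g t x\<bar> \<le> 1"
        by (simp add: g abs_mult)
    qed (simp add: g p)
    have "h = (\<Sum>t\<in>F. g t)"
    proof (rule bcontfun_eqI)
      fix x
      have "(\<Sum>t\<in>F. g t) x = (\<Sum>t\<in>F. g t x)"
        by (induction F rule: infinite_finite_induct) auto
      also have "\<dots> = h x * ((\<Sum>t\<in>F. p t x) / q x)"
        by (simp add: g sum_distrib_left sum_divide_distrib)
      also have "\<dots> = h x"
        using q[of x] by (simp flip: q_def)
      finally show "h x = (\<Sum>t\<in>F. g t) x" ..
    qed
    then have fh: "blinfun_apply f h = (\<Sum>t\<in>F. blinfun_apply f (g t))"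
      by (simp add: blinfun.sum_right)
    have mh: "blinfun_apply ?m h = (\<Sum>t\<in>F. a t * g t t)"
      by (simp add: blinfun.sum_left blinfun.scaleR_left b_def g p(1) mult.commute)
    have "blinfun_apply (f - ?m) h = (\<Sum>t\<in>F. blinfun_apply f (g t) - a t * g t t)"
      by (simp add: blinfun.diff_left fh mh sum_subtractf)
    also have "\<dots> \<le> (\<Sum>t\<in>F. d t)"
    proof (rule sum_mono)
      fix t assume "t \<in> F"
      from U(3)[OF gU[OF this]] show "blinfun_apply f (g t) - a t * g t t \<le> d t"
        by simp
    qed
    also have "\<dots> = e * (\<Sum>n\<in>idx ` F. (1/2) ^ Suc n)"
      using inj by (simp add: d_def sum.reindex inj_on_subset sum_distrib_left)
    also have "(\<Sum>n\<in>idx ` F. (1/2::real) ^ Suc n) \<le> 1"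
      using sum_le_suminf[OF sums_summable[OF power_half_series], of "idx ` F"] F
        sums_unique[OF power_half_series] by simp
    finally show "norm (f - ?m) \<le> e + e'"
      using h(2) e by simp
  qed
  then show ?thesis
    using that F by blast
qed

lemma countable_imp_separable_dual:
  assumes K: "compact (UNIV :: 'k::t2_space set)" and cnt: "countable (UNIV :: 'k set)"
  shows "separable_space (euclidean :: (('k \<Rightarrow>\<^sub>C real) \<Rightarrow>\<^sub>L real) topology)"
proof -
  define comb :: "(rat \<times> 'k) list \<Rightarrow> ('k \<Rightarrow>\<^sub>C real) \<Rightarrow>\<^sub>L real"
    where "comb xs = (\<Sum>(r, t)\<leftarrow>xs. of_rat r *\<^sub>R point_eval t)" for xs
  have "countable (lists (UNIV \<times> UNIV :: (rat \<times> 'k) set))"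
    using cnt by (intro countable_lists countable_SIGMA) auto
  then have cD: "countable (range comb)"
    by simp
  have combs: "(\<Sum>t\<in>F. a t *\<^sub>R point_eval t) \<in> closure (range comb)" if "finite F" for F a
    using that
  proof (induction F rule: finite_induct)
    case empty
    have "0 \<in> range comb"
      by (rule image_eqI[of _ _ "[]"]) (simp_all add: comb_def)
    then have "0 \<in> closure (range comb)"
      using closure_subset[of "range comb"] by (rule rev_subsetD)
    then show ?case
      by simp
  next
    case (insert t F)
    let ?s = "\<Sum>t\<in>F. a t *\<^sub>R point_eval t"
    show ?case
      unfolding closure_approachable
    proof (intro allI impI)
      fix e :: real assume e: "e > 0"
      have "\<exists>y\<in>range comb. dist y ?s < e / 2"
        using insert.IH[unfolded closure_approachable, rule_format, of "e / 2"] e by simp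
      then obtain xs where xs: "dist (comb xs) ?s < e / 2"
        by blast
      obtain r where r: "a t < of_rat r" "of_rat r < a t + e / 2"
        using of_rat_dense[of "a t" "a t + e / 2"] e by auto
      have cons: "comb ((r, t) # xs) = of_rat r *\<^sub>R point_eval t + comb xs"
        by (simp add: comb_def)
      have eq: "comb ((r, t) # xs) - (a t *\<^sub>R point_eval t + ?s) =
          (of_rat r - a t) *\<^sub>R point_eval t + (comb xs - ?s)"
        unfolding cons scaleR_left_diff_distrib by (rule add_diff_add)
      have "dist (comb ((r, t) # xs)) (a t *\<^sub>R point_eval t + ?s) \<le>
          norm ((of_rat r - a t) *\<^sub>R point_eval t) + norm (comb xs - ?s)"
        unfolding dist_norm eq by (rule norm_triangle_ineq)
      also have "\<dots> < e / 2 + e / 2"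
        using r xs by (intro add_strict_mono) (auto simp: norm_point_eval dist_norm)
      finally show "\<exists>y\<in>range comb. dist y (\<Sum>t\<in>insert t F. a t *\<^sub>R point_eval t) < e"
        by (intro bexI[of _ "comb ((r, t) # xs)"]) (simp_all add: insert.hyps)
    qed
  qed
  have "f \<in> closure (closure (range comb))" for f
    unfolding closure_approachable[of f "closure (range comb)"]
  proof (intro allI impI)
    fix e :: real assume e: "e > 0"
    then obtain F a where F: "finite F" "norm (f - (\<Sum>t\<in>F. a t *\<^sub>R point_eval t)) \<le> e / 2"
      using countable_imp_near_atomic[OF K cnt, of "e / 2" f] by auto
    then show "\<exists>y\<in>closure (range comb). dist y f < e"
      using combs[OF F(1), of a] e
      by (intro bexI[of _ "\<Sum>t\<in>F. a t *\<^sub>R point_eval t"]) (auto simp: dist_norm norm_minus_commute)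
  qed
  then have "closure (range comb) = UNIV"
    by auto
  then show ?thesis
    using cD unfolding separable_space_def by (intro exI[of _ "range comb"]) auto
qed

section \<open>Separable duals\<close>

text \<open>
  If \<open>A\<close> is dense in the dual sphere, some member of \<open>A\<close> is close to \<open>- f\<close>, yet at a point of
  \<open>B\<close> where it is at least \<open>l\<close> so is \<open>f\<close>.
\<close>

lemma separable_dual_imp_not_SD2P_omega:
  assumes sep: "separable_space (euclidean :: ('x::real_normed_vector \<Rightarrow>\<^sub>L real) topology)"
  shows "\<not> SD2P_omega TYPE('x)"
proof
  assume sd: "SD2P_omega TYPE('x)"
  obtain D :: "('x \<Rightarrow>\<^sub>L real) set" where D: "countable D" "closure D = UNIV"
    using sep by (auto simp: separable_space_def)
  define A where "A = sgn ` (D - {0})"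
  have "A \<subseteq> sphere 0 1"
    unfolding A_def by (rule image_subsetI) (simp add: norm_sgn)
  moreover have "countable A"
    using D unfolding A_def by (intro countable_image countable_Diff)
  ultimately have A: "A \<subseteq> sphere 0 1" "countable A" .
  obtain B and f :: "'x \<Rightarrow>\<^sub>L real"
    where B: "B \<subseteq> sphere (0::'x) 1" and f: "norm f = 1" and BA: "lnorms (1/2) B A"
    and fB: "\<And>x. x \<in> B \<Longrightarrow> blinfun_apply f x \<ge> 1/2"
    using sd[unfolded SD2P_omega_def, rule_format, OF A, of "1/2"] by auto
  have "- f \<in> closure D"
    using D by simp
  then obtain d where d: "d \<in> D" "norm (d + f) < 1/4"
    using closure_approachableD[of "- f" D "1/4"] by (auto simp: dist_norm norm_minus_commute)
  have nd: "\<bar>norm d - 1\<bar> < 1/4"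
    using norm_triangle_ineq3[of d "- f"] d f by simp
  then have "d \<noteq> 0" by auto
  have "norm (sgn d - d) = \<bar>1 - norm d\<bar>"
  proof -
    have "sgn d - d = (1 - norm d) *\<^sub>R sgn d"
      using \<open>d \<noteq> 0\<close> by (simp add: sgn_div_norm algebra_simps)
    then show ?thesis
      using \<open>d \<noteq> 0\<close> by (simp add: norm_sgn)
  qed
  then have near: "norm (sgn d + f) < 1/2"
    using norm_triangle_ineq[of "sgn d - d" "d + f"] d nd by (simp add: abs_minus_commute)
  have "sgn d \<in> A"
    using d \<open>d \<noteq> 0\<close> by (auto simp: A_def)
  then obtain x where x: "x \<in> B" "blinfun_apply (sgn d) x \<ge> 1/2 * norm (sgn d) * norm x"
    using BA unfolding lnorms_def by blast
  have nx: "norm x = 1"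
    using x B by auto
  have "1 \<le> blinfun_apply (sgn d + f) x"
    using x fB[OF x(1)] nx \<open>d \<noteq> 0\<close> by (simp add: blinfun.add_left norm_sgn)
  also have "\<dots> \<le> norm (sgn d + f)"
    using norm_blinfun[of "sgn d + f" x] nx by simp
  finally show False
    using near by simp
qed

lemma separable_imp_not_omega_octahedral:
  assumes "separable_space (euclidean :: 'z::real_normed_vector topology)"
  shows "\<not> omega_octahedral TYPE('z)"
proof
  assume "omega_octahedral TYPE('z)"
  then obtain z :: 'z where z: "norm z = 1"
    "\<And>y t. norm (y + t *\<^sub>R z) \<ge> (1 - 1/2) * (norm y + \<bar>t\<bar>)"
    using assms unfolding omega_octahedral_def
    by (elim allE[of _ UNIV] impE allE[of _ "1/2"]) auto
  \<comment> \<open>With \<open>Y\<close> the whole space, \<open>z\<close> itself is a vector that \<open>- z\<close> cancels.\<close>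
  from z(2)[of z "-1"] z(1) show False
    by simp
qed

section \<open>The equivalences\<close>

lemma ASD2P1_omega_imp_SD2P_omega:
  assumes "ASD2P1_omega TYPE('x::real_normed_vector)"
  shows "SD2P_omega TYPE('x)"
  unfolding SD2P_omega_def
proof (intro allI impI ballI)
  fix A :: "('x \<Rightarrow>\<^sub>L real) set" and l :: real
  assume A: "A \<subseteq> sphere 0 1" "countable A" and l: "l \<in> {0<..<1}"
  obtain B and f :: "'x \<Rightarrow>\<^sub>L real"
    where B: "B \<subseteq> sphere 0 1" "f \<in> sphere 0 1" "norms B A" "\<forall>x\<in>B. blinfun_apply f x = 1"
    using assms[unfolded ASD2P1_omega_def, rule_format, OF A] by blast
  have "lnorms l B A" "\<forall>x\<in>B. l \<le> blinfun_apply f x"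
    using B l by (auto simp: norms_def)
  with B show "\<exists>B\<subseteq>sphere 0 1. \<exists>f\<in>sphere 0 1. lnorms l B A \<and> (\<forall>x\<in>B. l \<le> blinfun_apply f x)"
    by blast
qed

lemma fails_minus1_BCP_omega_imp_omega_octahedral:
  assumes "fails_minus1_BCP_omega TYPE('z::real_normed_vector)"
  shows "omega_octahedral TYPE('z)"
  unfolding omega_octahedral_def
proof (intro allI impI)
  fix Y :: "'z set" and e :: real
  assume "subspace Y \<and> separable_space (top_of_set Y)" "e > 0"
  then obtain z where z: "z \<in> sphere 0 1"
    "\<And>y t. y \<in> Y \<Longrightarrow> norm (y + t *\<^sub>R z) \<ge> norm y + \<bar>t\<bar>"
    using assms unfolding fails_minus1_BCP_omega_def by blast
  have "norm (y + t *\<^sub>R z) \<ge> (1 - e) * (norm y + \<bar>t\<bar>)" if "y \<in> Y" for y t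
  proof -
    have "(1 - e) * (norm y + \<bar>t\<bar>) \<le> 1 * (norm y + \<bar>t\<bar>)"
      using \<open>e > 0\<close> by (intro mult_right_mono) auto
    then show ?thesis
      using z(2)[OF that, of t] by simp
  qed
  with z(1) show "\<exists>z\<in>sphere 0 1. \<forall>y\<in>Y. \<forall>t. (1 - e) * (norm y + \<bar>t\<bar>) \<le> norm (y + t *\<^sub>R z)"
    by blast
qed

lemma uncountable_iff_cardSuc_natLeq: "cardSuc natLeq \<le>o |A| \<longleftrightarrow> uncountable A"
  using cardSuc_ordLess_ordLeq[OF natLeq_Card_order card_of_Card_order, of A]
    not_ordLeq_iff_ordLess[OF natLeq_Well_order card_of_Well_order, of A]
  by (simp add: countable_card_le_natLeq)

theorem corollary6p5:
  assumes compact_K: "compact (UNIV :: 'k::t2_space set)"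
  shows "(cardSuc natLeq \<le>o |UNIV :: 'k set| \<longleftrightarrow> SD2P_omega TYPE('k \<Rightarrow>\<^sub>C real)) \<and>
    (SD2P_omega TYPE('k \<Rightarrow>\<^sub>C real) \<longleftrightarrow> ASD2P1_omega TYPE('k \<Rightarrow>\<^sub>C real)) \<and>
    (ASD2P1_omega TYPE('k \<Rightarrow>\<^sub>C real) \<longleftrightarrow>
      \<not> separable_space (euclidean :: (('k \<Rightarrow>\<^sub>C real) \<Rightarrow>\<^sub>L real) topology)) \<and>
    (\<not> separable_space (euclidean :: (('k \<Rightarrow>\<^sub>C real) \<Rightarrow>\<^sub>L real) topology) \<longleftrightarrow>
      omega_octahedral TYPE(('k \<Rightarrow>\<^sub>C real) \<Rightarrow>\<^sub>L real)) \<and>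
    (omega_octahedral TYPE(('k \<Rightarrow>\<^sub>C real) \<Rightarrow>\<^sub>L real) \<longleftrightarrow>
      fails_minus1_BCP_omega TYPE(('k \<Rightarrow>\<^sub>C real) \<Rightarrow>\<^sub>L real))"
  unfolding uncountable_iff_cardSuc_natLeq
  using uncountable_imp_ASD2P1_omega[OF compact_K]
    ASD2P1_omega_imp_SD2P_omega[where 'x = "'k \<Rightarrow>\<^sub>C real"]
    separable_dual_imp_not_SD2P_omega[where 'x = "'k \<Rightarrow>\<^sub>C real"]
    countable_imp_separable_dual[OF compact_K]
    uncountable_imp_fails_minus1_BCP_omega[OF compact_K]
    fails_minus1_BCP_omega_imp_omega_octahedral[where 'z = "('k \<Rightarrow>\<^sub>C real) \<Rightarrow>\<^sub>L real"]
    separable_imp_not_omega_octahedral[where 'z = "('k \<Rightarrow>\<^sub>C real) \<Rightarrow>\<^sub>L real"]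
  by blast

end
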